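(* In the two-firm baseline model with exogenous price described in the context, under the regularity assumption, the total welfares of the fragmented-Nash, pooled-Nash and pooled-planner regimes satisfy $$W^*_{\mathrm{NF}}\;\leq\; W^*_{\mathrm{NP}}\;\leq\; W^*_{\mathrm{SP}}.$$ The first inequality is strict whenever $\eta$ is strictly increasing on $[0,\infty)$. The second inequality is strict whenever $x_{\mathrm{NP}}\neq x_{\mathrm{SP}}$.
   Context: Parameters: $r>0$ (per-unit revenue), $c_1>0$, $c_2>0$ (capacity cost coefficients), $\delta\in(0,1]$ (discount factor). The learning curve $\eta:[0,\infty)\to[0,\infty)$ is twice continuously differentiable and bounded, and is either strictly increasing and strictly concave, or constant (the constant-learning benchmark); $\eta_{\min}:=\eta(0)$. Model: two symmetric firms choose capacities $K_{i,1}\ge 0$ and $K_{i,2}\ge K_{i,1}$; firm $i$'s profit is $rK_{i,1}\eta_{\min}-\frac{c_1}{2}K_{i,1}^2+\delta[rK_{i,2}\eta(N)-\frac{c_2}{2}(K_{i,2}-K_{i,1})^2]$, where the period-2 learning state is $N=K_{i,1}$ under fragmentation and $N=K_{1,1}+K_{2,1}$ under pooling. Substituting the optimal period-2 capacity gives the following reduced forms, taken as definitions. For $K,N\ge 0$, $$\phi(K,N):=rK\eta(N)+\frac{r^2}{2c_2}\eta(N)^2 .$$ For $x,x_i,x_j\ge 0$, $$V_{\mathrm{NF}}(x):=r\eta_{\min}x-\tfrac{c_1}{2}x^2+\delta\phi(x,x),\qquad V_{\mathrm{SP}}(x):=r\eta_{\min}x-\tfrac{c_1}{2}x^2+\delta\phi(x,2x),$$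 $$V_i^{\mathrm{NP}}(x_i,x_j):=r\eta_{\min}x_i-\tfrac{c_1}{2}x_i^2+\delta\phi(x_i,x_i+x_j).$$ The first-order conditions are $F_{\mathrm{NF}}:=V_{\mathrm{NF}}'$, $F_{\mathrm{SP}}:=V_{\mathrm{SP}}'$, $F_{\mathrm{NP}}(x):=\partial_{x_i}V_i^{\mathrm{NP}}(x_i,x_j)\big|_{x_i=x_j=x}$. Regularity assumption: $\eta(N)>0$ for all $N\ge 0$; $V_{\mathrm{NF}}$ and $V_{\mathrm{SP}}$ are strictly concave on $[0,\infty)$; $V_i^{\mathrm{NP}}(\cdot,x_j)$ is strictly concave on $[0,\infty)$ for every $x_j\ge 0$; and $F_{\mathrm{NF}},F_{\mathrm{NP}},F_{\mathrm{SP}}$ are strictly decreasing with unique interior roots $x_{\mathrm{NF}},x_{\mathrm{NP}},x_{\mathrm{SP}}\in(0,\infty)$ respectively. Welfares: $W^*_{\mathrm{NF}}:=2V_{\mathrm{NF}}(x_{\mathrm{NF}})$, $W^*_{\mathrm{NP}}:=2V_{\mathrm{SP}}(x_{\mathrm{NP}})$, $W^*_{\mathrm{SP}}:=2V_{\mathrm{SP}}(x_{\mathrm{SP}})$ (note $V_i^{\mathrm{NP}}(x,x)=V_{\mathrm{SP}}(x)$). *)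

theory Defs
  imports "HOL-Analysis.Analysis"
begin

definition strictly_concave_on :: "real set \<Rightarrow> (real \<Rightarrow> real) \<Rightarrow> bool" where
  "strictly_concave_on S f \<longleftrightarrow> convex S \<and>
     (\<forall>x\<in>S. \<forall>y\<in>S. \<forall>t. x \<noteq> y \<and> 0 < t \<and> t < 1 \<longrightarrow>
        (1 - t) * f x + t * f y < f ((1 - t) * x + t * y))"

(* Functions on [0,\<infinity>) are total functions on the reals that are only constrained on {0..}.
   Derivatives are taken within {0..}: two-sided at interior points, right-sided at 0. *)

definition twice_cont_differentiable_on :: "real set \<Rightarrow> (real \<Rightarrow> real) \<Rightarrow> bool" where
  "twice_cont_differentiable_on S f \<longleftrightarrow>
     (\<exists>f' f''. (\<forall>x\<in>S. (f has_real_derivative f' x) (at x within S)) \<and>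
               (\<forall>x\<in>S. (f' has_real_derivative f'' x) (at x within S)) \<and>
               continuous_on S f'')"

definition learning_curve :: "(real \<Rightarrow> real) \<Rightarrow> bool" where
  "learning_curve \<eta> \<longleftrightarrow>
     \<eta> ` {0..} \<subseteq> {0..} \<and>
     twice_cont_differentiable_on {0..} \<eta> \<and>
     bounded (\<eta> ` {0..}) \<and>
     (strict_mono_on {0..} \<eta> \<and> strictly_concave_on {0..} \<eta> \<or> \<eta> constant_on {0..})"

definition \<phi> :: "real \<Rightarrow> real \<Rightarrow> (real \<Rightarrow> real) \<Rightarrow> real \<Rightarrow> real \<Rightarrow> real" where
  "\<phi> r c2 \<eta> K N = r * K * \<eta> N + r\<^sup>2 / (2 * c2) * (\<eta> N)\<^sup>2"

definition V_NF :: "real \<Rightarrow> real \<Rightarrow> real \<Rightarrow> real \<Rightarrow> (real \<Rightarrow> real) \<Rightarrow> real \<Rightarrow> real" where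
  "V_NF r c1 c2 \<delta> \<eta> x = r * \<eta> 0 * x - c1 / 2 * x\<^sup>2 + \<delta> * \<phi> r c2 \<eta> x x"

definition V_SP :: "real \<Rightarrow> real \<Rightarrow> real \<Rightarrow> real \<Rightarrow> (real \<Rightarrow> real) \<Rightarrow> real \<Rightarrow> real" where
  "V_SP r c1 c2 \<delta> \<eta> x = r * \<eta> 0 * x - c1 / 2 * x\<^sup>2 + \<delta> * \<phi> r c2 \<eta> x (2 * x)"

(* own capacity first, the rival's second; by symmetry the same function serves both firms *)
definition V_NP :: "real \<Rightarrow> real \<Rightarrow> real \<Rightarrow> real \<Rightarrow> (real \<Rightarrow> real) \<Rightarrow> real \<Rightarrow> real \<Rightarrow> real" where
  "V_NP r c1 c2 \<delta> \<eta> xi xj = r * \<eta> 0 * xi - c1 / 2 * xi\<^sup>2 + \<delta> * \<phi> r c2 \<eta> xi (xi + xj)"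

definition F_NF :: "real \<Rightarrow> real \<Rightarrow> real \<Rightarrow> real \<Rightarrow> (real \<Rightarrow> real) \<Rightarrow> real \<Rightarrow> real" where
  "F_NF r c1 c2 \<delta> \<eta> x = vector_derivative (V_NF r c1 c2 \<delta> \<eta>) (at x within {0..})"

definition F_SP :: "real \<Rightarrow> real \<Rightarrow> real \<Rightarrow> real \<Rightarrow> (real \<Rightarrow> real) \<Rightarrow> real \<Rightarrow> real" where
  "F_SP r c1 c2 \<delta> \<eta> x = vector_derivative (V_SP r c1 c2 \<delta> \<eta>) (at x within {0..})"

definition F_NP :: "real \<Rightarrow> real \<Rightarrow> real \<Rightarrow> real \<Rightarrow> (real \<Rightarrow> real) \<Rightarrow> real \<Rightarrow> real" where
  "F_NP r c1 c2 \<delta> \<eta> x = vector_derivative (\<lambda>xi. V_NP r c1 c2 \<delta> \<eta> xi x) (at x within {0..})"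

definition regularity :: "real \<Rightarrow> real \<Rightarrow> real \<Rightarrow> real \<Rightarrow> (real \<Rightarrow> real) \<Rightarrow> bool" where
  "regularity r c1 c2 \<delta> \<eta> \<longleftrightarrow>
     (\<forall>N\<ge>0. \<eta> N > 0) \<and>
     strictly_concave_on {0..} (V_NF r c1 c2 \<delta> \<eta>) \<and>
     strictly_concave_on {0..} (V_SP r c1 c2 \<delta> \<eta>) \<and>
     (\<forall>xj\<ge>0. strictly_concave_on {0..} (\<lambda>xi. V_NP r c1 c2 \<delta> \<eta> xi xj)) \<and>
     monotone_on {0..} (<) (>) (F_NF r c1 c2 \<delta> \<eta>) \<and>
     monotone_on {0..} (<) (>) (F_NP r c1 c2 \<delta> \<eta>) \<and>
     monotone_on {0..} (<) (>) (F_SP r c1 c2 \<delta> \<eta>) \<and>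
     (\<exists>!x. x > 0 \<and> F_NF r c1 c2 \<delta> \<eta> x = 0) \<and>
     (\<exists>!x. x > 0 \<and> F_NP r c1 c2 \<delta> \<eta> x = 0) \<and>
     (\<exists>!x. x > 0 \<and> F_SP r c1 c2 \<delta> \<eta> x = 0)"

definition x_NF :: "real \<Rightarrow> real \<Rightarrow> real \<Rightarrow> real \<Rightarrow> (real \<Rightarrow> real) \<Rightarrow> real" where
  "x_NF r c1 c2 \<delta> \<eta> = (THE x. x > 0 \<and> F_NF r c1 c2 \<delta> \<eta> x = 0)"

definition x_NP :: "real \<Rightarrow> real \<Rightarrow> real \<Rightarrow> real \<Rightarrow> (real \<Rightarrow> real) \<Rightarrow> real" where
  "x_NP r c1 c2 \<delta> \<eta> = (THE x. x > 0 \<and> F_NP r c1 c2 \<delta> \<eta> x = 0)"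

definition x_SP :: "real \<Rightarrow> real \<Rightarrow> real \<Rightarrow> real \<Rightarrow> (real \<Rightarrow> real) \<Rightarrow> real" where
  "x_SP r c1 c2 \<delta> \<eta> = (THE x. x > 0 \<and> F_SP r c1 c2 \<delta> \<eta> x = 0)"

definition W_NF :: "real \<Rightarrow> real \<Rightarrow> real \<Rightarrow> real \<Rightarrow> (real \<Rightarrow> real) \<Rightarrow> real" where
  "W_NF r c1 c2 \<delta> \<eta> = 2 * V_NF r c1 c2 \<delta> \<eta> (x_NF r c1 c2 \<delta> \<eta>)"

(* V_SP, not V_NP: the two agree on the diagonal, see V_NP_diag *)
definition W_NP :: "real \<Rightarrow> real \<Rightarrow> real \<Rightarrow> real \<Rightarrow> (real \<Rightarrow> real) \<Rightarrow> real" where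
  "W_NP r c1 c2 \<delta> \<eta> = 2 * V_SP r c1 c2 \<delta> \<eta> (x_NP r c1 c2 \<delta> \<eta>)"

definition W_SP :: "real \<Rightarrow> real \<Rightarrow> real \<Rightarrow> real \<Rightarrow> (real \<Rightarrow> real) \<Rightarrow> real" where
  "W_SP r c1 c2 \<delta> \<eta> = 2 * V_SP r c1 c2 \<delta> \<eta> (x_SP r c1 c2 \<delta> \<eta>)"

lemma V_NP_diag: "V_NP r c1 c2 \<delta> \<eta> x x = V_SP r c1 c2 \<delta> \<eta> x"
  by (simp add: V_NP_def V_SP_def flip: mult_2)

end

theory Submission
  imports Defs
begin

text \<open>
  Let \<open>a\<close> be the pooled-Nash capacity. By concavity, \<open>a\<close> is a best response to itself, so it
  beats the deviation to the fragmented optimum \<open>x\<close>; and this deviation already yields at least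
  the fragmented profit, because the rival's capacity \<open>a\<close> can only raise the learning state from
  \<open>x\<close> to \<open>x + a\<close>. The second inequality holds because the planner's root is the unique maximiser
  of the strictly concave planner objective.
\<close>

text \<open>The tangent to the convex function \<open>- f\<close> at \<open>x\<close> is horizontal,
  so \<open>x\<close> maximises \<open>f\<close> on \<open>S\<close>. The value at the midpoint of
  \<open>x\<close> and \<open>y\<close> is then at most \<open>f x\<close>, yet by strict concavity
  it exceeds the average of \<open>f x\<close> and \<open>f y\<close>.\<close>

lemma strictly_concave_on_stationary_less:
  fixes f :: "real \<Rightarrow> real"
  assumes conc: "strictly_concave_on S f"
    and x: "x \<in> interior S" and y: "y \<in> S" "y \<noteq> x"
    and deriv: "(f has_real_derivative 0) (at x within S)"
  shows "f y < f x"
proof -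
  have S: "convex S" and xS: "x \<in> S"
    using conc x interior_subset by (auto simp: strictly_concave_on_def)
  have "convex_on S (\<lambda>z. - f z)"
  proof (rule convex_onI)
    fix t u v :: real
    assume "0 < t" "t < 1" "u \<in> S" "v \<in> S"
    then have "(1 - t) * f u + t * f v < f ((1 - t) * u + t * v)" if "u \<noteq> v"
      using conc that unfolding strictly_concave_on_def by blast
    then show "- f ((1 - t) *\<^sub>R u + t *\<^sub>R v) \<le> (1 - t) * - f u + t * - f v"
      by (cases "u = v") (simp add: algebra_simps, simp)
  qed (rule S)
  then have max: "f z \<le> f x" if "z \<in> S" for z
    using convex_on_imp_above_tangent[of S "\<lambda>z. - f z" x z 0] S x that DERIV_minus[OF deriv]
    by (simp add: convex_connected)
  \<comment> \<open>The midpoint is kept in the shape that \<open>strictly_concave_on_def\<close>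
    produces at weight 1/2.\<close>
  have "(1 - 1/2) * x + 1/2 * y \<in> S"
    using convexD[OF S xS y(1), of "1/2" "1/2"] by simp
  from max[OF this] have "f ((1 - 1/2) * x + 1/2 * y) \<le> f x" .
  moreover have "(1 - 1/2) * f x + 1/2 * f y < f ((1 - 1/2) * x + 1/2 * y)"
    using conc xS y unfolding strictly_concave_on_def
    by (elim conjE ballE allE[of _ "1/2"]) (auto simp: add.commute)
  ultimately show ?thesis by simp
qed

text \<open>Fits the stationarity criterion to the first-order conditions, which are stated with
  \<open>vector_derivative\<close>. That operator is a choice of some derivative, so its being 0
  carries information only together with differentiability.\<close>

lemma strictly_concave_on_stationary_less_nonneg:
  fixes f :: "real \<Rightarrow> real"
  assumes "strictly_concave_on {0..} f" and "0 < x" and "0 \<le> y" "y \<noteq> x"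
    and "f differentiable (at x)" and "vector_derivative f (at x within {0..}) = 0"
  shows "f y < f x"
proof (rule strictly_concave_on_stationary_less[OF assms(1)])
  have "f differentiable (at x within {0..})"
    using assms(5) by (rule differentiable_at_withinI)
  then have "(f has_vector_derivative 0) (at x within {0..})"
    unfolding vector_derivative_works assms(6) .
  then show "(f has_real_derivative 0) (at x within {0..})"
    by (simp only: has_real_derivative_iff_has_vector_derivative)
qed (use assms in auto)

text \<open>A positive point is interior to the half-line, so there the derivative within
  \<open>{0..}\<close> is two-sided.\<close>

lemma learning_curve_differentiable_at:
  assumes "learning_curve \<eta>" and "0 < x"
  obtains D where "(\<eta> has_real_derivative D) (at x)"
proof -
  have "twice_cont_differentiable_on {0..} \<eta>"
    using assms(1) by (simp add: learning_curve_def)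
  then obtain \<eta>' where "\<forall>x\<in>{0..}. (\<eta> has_real_derivative \<eta>' x) (at x within {0..})"
    unfolding twice_cont_differentiable_on_def by blast
  then have "(\<eta> has_real_derivative \<eta>' x) (at x within {0..})"
    using assms(2) by simp
  then have "(\<eta> has_real_derivative \<eta>' x) (at x)"
    using \<open>0 < x\<close> by (simp add: at_within_interior[of x "{0..}"])
  then show thesis by (rule that)
qed

lemma learning_curve_mono:
  assumes "learning_curve \<eta>" "0 \<le> x" "x \<le> y"
  shows "\<eta> x \<le> \<eta> y"
proof -
  consider "strict_mono_on {0..} \<eta>" | "\<eta> constant_on {0..}"
    using assms(1) by (auto simp: learning_curve_def)
  then show ?thesis
  proof cases
    case 1
    from mono_onD[OF strict_mono_on_imp_mono_on[OF this]] show ?thesis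
      using assms(2,3) by simp
  next
    case 2
    then obtain c where "\<forall>x\<in>{0..}. \<eta> x = c"
      unfolding constant_on_def ..
    then show ?thesis using assms(2,3) by simp
  qed
qed

text \<open>The affine learning state \<open>k * x + b\<close> covers both pooled objectives:
  \<open>k = 2\<close>, \<open>b = 0\<close> for the planner, and \<open>k = 1\<close> with
  \<open>b\<close> the rival's capacity for the Nash game.\<close>

lemma profit_differentiable:
  fixes k b x :: real
  assumes "learning_curve \<eta>" and "0 < k * x + b"
  shows "(\<lambda>x. r * \<eta> 0 * x - c1 / 2 * x\<^sup>2 + \<delta> * \<phi> r c2 \<eta> x (k * x + b)) differentiable (at x)"
proof -
  obtain D where D: "(\<eta> has_real_derivative D) (at (k * x + b))"
    using learning_curve_differentiable_at[OF assms] .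
  have "((\<lambda>x. \<eta> (k * x + b)) has_real_derivative D * k) (at x)"
    by (rule DERIV_chain2[where g = "\<lambda>x. k * x + b", OF D]) (auto intro!: derivative_eq_intros)
  then have h: "(\<lambda>x. \<eta> (k * x + b)) differentiable (at x)"
    unfolding real_differentiable_def by (rule exI)
  \<comment> \<open>With an opaque \<open>h\<close> the structural rules stop at the learning term,
    where the differentiability just shown closes the goal.\<close>
  have "(\<lambda>x. r * \<eta> 0 * x - c1 / 2 * x\<^sup>2 + \<delta> * (r * x * h x + r\<^sup>2 / (2 * c2) * (h x)\<^sup>2))
      differentiable (at x)" if "h differentiable (at x)" for h :: "real \<Rightarrow> real"
    by (intro differentiable_add differentiable_diff differentiable_mult differentiable_power
        differentiable_const differentiable_ident that)
  from this[OF h] show ?thesis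
    unfolding \<phi>_def .
qed

lemma V_SP_differentiable:
  assumes "learning_curve \<eta>" and "0 < x"
  shows "V_SP r c1 c2 \<delta> \<eta> differentiable (at x)"
  using profit_differentiable[OF assms(1), of 2 x 0 r c1 \<delta> c2] assms(2)
  by (simp add: V_SP_def[abs_def])

lemma V_NP_differentiable:
  assumes "learning_curve \<eta>" and "0 < x + b"
  shows "(\<lambda>x. V_NP r c1 c2 \<delta> \<eta> x b) differentiable (at x)"
  using profit_differentiable[OF assms(1), of 1 x b r c1 \<delta> c2] assms(2)
  by (simp add: V_NP_def)

lemma \<phi>_mono:
  assumes "0 \<le> r" "0 \<le> c2" "0 \<le> K" "0 \<le> \<eta> M" "\<eta> M \<le> \<eta> N"
  shows "\<phi> r c2 \<eta> K M \<le> \<phi> r c2 \<eta> K N"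
  unfolding \<phi>_def using assms by (intro add_mono mult_left_mono power_mono) auto

text \<open>Strictness comes from the revenue term \<open>r * K * \<eta> N\<close>, hence
  \<open>0 < K\<close>; the quadratic term is compared only weakly.\<close>

lemma \<phi>_strict_mono:
  assumes "0 < r" "0 \<le> c2" "0 < K" "0 \<le> \<eta> M" "\<eta> M < \<eta> N"
  shows "\<phi> r c2 \<eta> K M < \<phi> r c2 \<eta> K N"
  unfolding \<phi>_def using assms
  by (intro add_less_le_mono mult_strict_left_mono mult_left_mono power_mono) auto

theorem proposition1:
  fixes r c1 c2 \<delta> :: real and \<eta> :: "real \<Rightarrow> real"
  assumes "r > 0" and "c1 > 0" and "c2 > 0" and "0 < \<delta>" and "\<delta> \<le> 1"
    and "learning_curve \<eta>"
    and "regularity r c1 c2 \<delta> \<eta>"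
  shows "W_NF r c1 c2 \<delta> \<eta> \<le> W_NP r c1 c2 \<delta> \<eta> \<and>
         W_NP r c1 c2 \<delta> \<eta> \<le> W_SP r c1 c2 \<delta> \<eta> \<and>
         (strict_mono_on {0..} \<eta> \<longrightarrow> W_NF r c1 c2 \<delta> \<eta> < W_NP r c1 c2 \<delta> \<eta>) \<and>
         (x_NP r c1 c2 \<delta> \<eta> \<noteq> x_SP r c1 c2 \<delta> \<eta> \<longrightarrow> W_NP r c1 c2 \<delta> \<eta> < W_SP r c1 c2 \<delta> \<eta>)"
proof -
  define x a s where "x = x_NF r c1 c2 \<delta> \<eta>" and "a = x_NP r c1 c2 \<delta> \<eta>"
    and "s = x_SP r c1 c2 \<delta> \<eta>"
  have positive: "\<forall>N\<ge>0. 0 < \<eta> N"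
    and conc_SP: "strictly_concave_on {0..} (V_SP r c1 c2 \<delta> \<eta>)"
    and conc_NP: "\<forall>b\<ge>0. strictly_concave_on {0..} (\<lambda>y. V_NP r c1 c2 \<delta> \<eta> y b)"
    and root_NF: "\<exists>!x. x > 0 \<and> F_NF r c1 c2 \<delta> \<eta> x = 0"
    and root_NP: "\<exists>!x. x > 0 \<and> F_NP r c1 c2 \<delta> \<eta> x = 0"
    and root_SP: "\<exists>!x. x > 0 \<and> F_SP r c1 c2 \<delta> \<eta> x = 0"
    by (insert assms(7)[unfolded regularity_def]) (elim conjE, assumption)+
  have x: "0 < x"
    using theI'[OF root_NF] by (simp add: x_def x_NF_def)
  have a: "0 < a" "F_NP r c1 c2 \<delta> \<eta> a = 0"
    using theI'[OF root_NP] by (simp_all add: a_def x_NP_def)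
  have s: "0 < s" "F_SP r c1 c2 \<delta> \<eta> s = 0"
    using theI'[OF root_SP] by (simp_all add: s_def x_SP_def)
  have pos: "0 \<le> \<eta> x"
    using positive x by (simp add: less_imp_le)

  have "V_NP r c1 c2 \<delta> \<eta> x a < V_NP r c1 c2 \<delta> \<eta> a a" if "x \<noteq> a"
  proof (rule strictly_concave_on_stationary_less_nonneg[
      where f = "\<lambda>y. V_NP r c1 c2 \<delta> \<eta> y a"])
    show "strictly_concave_on {0..} (\<lambda>y. V_NP r c1 c2 \<delta> \<eta> y a)"
      using conc_NP a by simp
    show "(\<lambda>y. V_NP r c1 c2 \<delta> \<eta> y a) differentiable (at a)"
      using V_NP_differentiable[OF assms(6)] a by simp
    show "vector_derivative (\<lambda>y. V_NP r c1 c2 \<delta> \<eta> y a) (at a within {0..}) = 0"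
      using a by (simp add: F_NP_def)
  qed (use a x that in auto)
  \<comment> \<open>On the diagonal the Nash profit is the planner's objective, the form in which
    \<open>W_NP\<close> is defined.\<close>
  then have best_response: "V_NP r c1 c2 \<delta> \<eta> x a \<le> V_SP r c1 c2 \<delta> \<eta> a"
    by (cases "x = a") (auto simp: V_NP_diag)
  have "\<eta> x \<le> \<eta> (x + a)"
    using learning_curve_mono[OF assms(6)] x a by simp
  \<comment> \<open>At equal own capacity the two profits differ only in the second argument of
    \<open>\<phi>\<close>.\<close>
  then have "V_NF r c1 c2 \<delta> \<eta> x \<le> V_NP r c1 c2 \<delta> \<eta> x a"
    unfolding V_NF_def V_NP_def using assms x pos by (auto intro!: mult_left_mono \<phi>_mono)
  moreover have "V_NF r c1 c2 \<delta> \<eta> x < V_NP r c1 c2 \<delta> \<eta> x a" if "strict_mono_on {0..} \<eta>"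
  proof -
    have "\<eta> x < \<eta> (x + a)"
      using strict_mono_onD[OF that] x a by simp
    then show ?thesis
      unfolding V_NF_def V_NP_def using assms x pos
      by (auto intro!: mult_strict_left_mono \<phi>_strict_mono)
  qed
  moreover have "V_SP r c1 c2 \<delta> \<eta> a < V_SP r c1 c2 \<delta> \<eta> s" if "a \<noteq> s"
  proof (rule strictly_concave_on_stationary_less_nonneg[where f = "V_SP r c1 c2 \<delta> \<eta>"])
    show "V_SP r c1 c2 \<delta> \<eta> differentiable (at s)"
      using V_SP_differentiable[OF assms(6)] s by simp
    show "vector_derivative (V_SP r c1 c2 \<delta> \<eta>) (at s within {0..}) = 0"
      using s by (simp add: F_SP_def)
  qed (use a s that conc_SP in auto)
  \<comment> \<open>If \<open>a = s\<close>, the last two welfares coincide; otherwise the planner's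
    root is strictly better.\<close>
  ultimately show ?thesis
    unfolding W_NF_def W_NP_def W_SP_def x_def[symmetric] a_def[symmetric] s_def[symmetric]
    using best_response by (cases "a = s") auto
qed

end
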